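(* Let $m\ge 3$ be an integer. Every real number $x\in[0,1]$ has a continued logarithm representation to base $m$, i.e. there is a sequence $(d_k)_{k\ge1}\in\{1,\dots,m-1\}^{\mathbb{N}}$ with $x=[(d_k)]_m$. Moreover, there is a countable set $E\subset[0,1]$ such that for every $x\in[0,1]\setminus E$ this representation is unique.
   Context: For an integer $m\ge3$ and $d\in\{1,\dots,m-1\}$ let $T_d:[0,1]\to[0,1]$, $T_d(x)=\log_m(d+x)$; these maps are contractions of $[0,1]$. For a sequence $(d_k)_{k\ge1}\in\{1,\dots,m-1\}^{\mathbb{N}}$ the continued logarithm to base $m$ is $$[(d_k)]_m=\lim_{n\to\infty}T_{d_1}\circ T_{d_2}\circ\cdots\circ T_{d_n}(0)=\lim_{n\to\infty}\log_m(d_1+\log_m(d_2+\cdots+\log_m(d_n)\cdots)).$$ The limit exists and lies in $[0,1]$. A sequence $(d_k)$ with $[(d_k)]_m=x$ is called a continued logarithm representation of $x$ to base $m$. Countable means finite or countably infinite. *)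

theory Defs
  imports "HOL-Analysis.Analysis"
begin

definition clog_map :: "nat \<Rightarrow> nat \<Rightarrow> real \<Rightarrow> real" where
  "clog_map m d x = log (real m) (real d + x)"

text \<open>Digit sequences are indexed from 0: \<open>d k\<close> is the digit usually written with index
  \<open>k + 1\<close>. Thus \<open>clog_comp m d n\<close> is the composition of the maps for the digits
  \<open>d 0, \<dots>, d (n - 1)\<close>, where the map for \<open>d 0\<close> is outermost.\<close>

primrec clog_comp :: "nat \<Rightarrow> (nat \<Rightarrow> nat) \<Rightarrow> nat \<Rightarrow> real \<Rightarrow> real" where
  "clog_comp m d 0 = id"
| "clog_comp m d (Suc n) = clog_comp m d n \<circ> clog_map m (d n)"

text \<open>The limit is stated as convergence to \<open>x\<close>, rather than as an equation with \<^const>\<open>lim\<close>, so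
  that the existence of the limit is part of being a representation.\<close>

definition clog_representation :: "nat \<Rightarrow> (nat \<Rightarrow> nat) \<Rightarrow> real \<Rightarrow> bool" where
  "clog_representation m d x \<longleftrightarrow>
     (\<forall>k. d k \<in> {1..m - 1}) \<and> (\<lambda>n. clog_comp m d n 0) \<longlonglongrightarrow> x"

end

theory Submission
  imports Defs
begin

text \<open>The maps \<open>T\<^sub>d\<close> are contractions whose images \<open>[log\<^sub>m d, log\<^sub>m (d + 1)]\<close> cover \<open>[0, 1]\<close> and meet
  only in the points \<open>log\<^sub>m e = T\<^sub>e 0\<close>. Covering produces digits, contraction produces convergence.
  At the first index where two representations of \<open>x\<close> differ, the tails lie in such a common
  endpoint, so \<open>x\<close> is obtained from \<open>0\<close> by finitely many of the maps.\<close>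

lemma clog_map_nonneg:
  assumes "m \<ge> 3" "d \<ge> 1" "x \<ge> 0"
  shows "clog_map m d x \<ge> 0"
  using assms by (simp add: clog_map_def)

text \<open>Since the digit is at least 1, \<open>ln\<close> is evaluated only on [1, \<infinity>),
  where its slope is at most 1. Changing to base \<open>m\<close> contributes the factor
  \<open>1 / ln m\<close>.\<close>

lemma clog_map_contraction:
  assumes "m \<ge> 3" "d \<ge> 1" "x \<ge> 0" "y \<ge> 0"
  shows "\<bar>clog_map m d x - clog_map m d y\<bar> \<le> (1 / ln (real m)) * \<bar>x - y\<bar>"
proof -
  have *: "\<bar>ln (real d + x) - ln (real d + y)\<bar> \<le> \<bar>x - y\<bar>" if "0 \<le> y" "y \<le> x" for x y :: real
  proof -
    have "ln (real d + x) - ln (real d + y) \<le> (real d + x - (real d + y)) / (real d + y)"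
      using that assms(2) by (intro ln_diff_le) auto
    also have "\<dots> \<le> (x - y) / 1"
      using that assms(2) by (intro frac_le) auto
    finally show ?thesis
      using that assms(2) by simp
  qed
  have "\<bar>ln (real d + x) - ln (real d + y)\<bar> \<le> \<bar>x - y\<bar>"
    using *[of x y] *[of y x] assms(3,4) by (cases "y \<le> x") auto
  moreover have ln: "ln (real m) > 0"
    using assms(1) by simp
  ultimately have "\<bar>ln (real d + x) - ln (real d + y)\<bar> / ln (real m) \<le> \<bar>x - y\<bar> / ln (real m)"
    by (intro divide_right_mono) auto
  then show ?thesis
    using ln by (simp add: clog_map_def log_def flip: diff_divide_distrib)
qed

lemma clog_comp_contraction:
  assumes "m \<ge> 3" "\<And>k. d k \<ge> 1" "x \<ge> 0" "y \<ge> 0"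
  shows "\<bar>clog_comp m d n x - clog_comp m d n y\<bar> \<le> (1 / ln (real m)) ^ n * \<bar>x - y\<bar>"
  using assms(3,4)
proof (induction n arbitrary: x y)
  case 0
  then show ?case by simp
next
  case (Suc n)
  have "\<bar>clog_comp m d (Suc n) x - clog_comp m d (Suc n) y\<bar>
      \<le> (1 / ln (real m)) ^ n * \<bar>clog_map m (d n) x - clog_map m (d n) y\<bar>"
    unfolding clog_comp.simps comp_apply
    using Suc.prems assms(1,2) by (intro Suc.IH clog_map_nonneg)
  also have "\<dots> \<le> (1 / ln (real m)) ^ n * ((1 / ln (real m)) * \<bar>x - y\<bar>)"
    using Suc.prems assms(1,2)
    by (intro mult_left_mono clog_map_contraction zero_le_power divide_nonneg_nonneg) simp_all
  finally show ?case
    by (simp only: power_Suc2 mult.assoc)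
qed

text \<open>This is where \<open>m \<ge> 3\<close> matters: 3 exceeds e, so the Lipschitz constant
  is a genuine contraction factor. For base 2 it would exceed 1.\<close>

lemma inverse_ln_less_1:
  assumes "m \<ge> 3"
  shows "1 / ln (real m) < 1"
proof -
  have "ln 3 \<le> ln (real m)"
    using assms by simp
  then have "1 < ln (real m)"
    using ln3_gt_1 by linarith
  then show ?thesis by simp
qed

text \<open>Replacing the exact remainder \<open>y n\<close> by 0 changes the value of the
  \<open>n\<close>-fold composition by at most the \<open>n\<close>-th power of the contraction
  factor, so the error tends to 0.\<close>

lemma clog_representationI:
  assumes "m \<ge> 3" "\<And>k. d k \<in> {1..m - 1}"
    and "\<And>n. y n \<in> {0..1}" "\<And>n. clog_comp m d n (y n) = x"
  shows "clog_representation m d x"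
proof -
  have "(\<lambda>n. clog_comp m d n 0 - x) \<longlonglongrightarrow> 0"
  proof (rule Lim_null_comparison)
    show "\<forall>\<^sub>F n in sequentially. norm (clog_comp m d n 0 - x) \<le> (1 / ln (real m)) ^ n"
    proof (intro always_eventually allI)
      fix n
      have "\<bar>clog_comp m d n 0 - clog_comp m d n (y n)\<bar> \<le> (1 / ln (real m)) ^ n * \<bar>0 - y n\<bar>"
        using assms(1-3) by (intro clog_comp_contraction) auto
      also have "\<dots> \<le> (1 / ln (real m)) ^ n * 1"
        using assms(1,3) by (intro mult_left_mono) auto
      finally show "norm (clog_comp m d n 0 - x) \<le> (1 / ln (real m)) ^ n"
        by (simp add: assms(4))
    qed
    show "(\<lambda>n. (1 / ln (real m)) ^ n) \<longlonglongrightarrow> 0"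
      using inverse_ln_less_1[OF assms(1)] assms(1) by (intro LIMSEQ_power_zero) simp
  qed
  then show ?thesis
    using assms(2) by (simp add: clog_representation_def LIM_zero_iff)
qed

text \<open>The digit is the integer part of \<open>m powr x\<close> and the remainder is its
  fractional part.\<close>

lemma clog_map_covers:
  assumes "m \<ge> 3" "x \<in> {0..1}"
  shows "\<exists>d\<in>{1..m - 1}. \<exists>y\<in>{0..1}. clog_map m d y = x"
proof -
  define t where "t = real m powr x"
  have t1: "1 \<le> t" and tm: "t \<le> real m"
    using assms powr_mono[of 0 x "real m"] powr_mono[of x 1 "real m"] by (auto simp: t_def)
  have logt: "log (real m) t = x"
    using assms(1) by (simp add: t_def)
  show ?thesis
  proof (cases "t = real m")
    \<comment> \<open>Here \<open>x = 1\<close>, and the integer part would be the inadmissible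
      digit \<open>m\<close>. The digit \<open>m - 1\<close> with remainder 1 is taken
      instead.\<close>
    case True
    then have "clog_map m (m - 1) 1 = x"
      using logt assms(1) by (simp add: clog_map_def of_nat_diff)
    then show ?thesis
      using assms(1) by (intro bexI[of _ "m - 1"] bexI[of _ 1]) auto
  next
    case False
    define d where "d = nat \<lfloor>t\<rfloor>"
    have "real d \<le> t" "t < real d + 1" "d \<ge> 1"
      using t1 unfolding d_def by linarith+
    moreover have "d < m"
      using \<open>real d \<le> t\<close> tm False by linarith
    ultimately show ?thesis
      using logt by (intro bexI[of _ d] bexI[of _ "t - real d"]) (auto simp: clog_map_def)
  qed
qed

lemma clog_representation_exists:
  assumes "m \<ge> 3" "x \<in> {0..1}"
  shows "\<exists>d. clog_representation m d x"
proof -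
  obtain f g where fg: "\<And>x. x \<in> {0..1} \<Longrightarrow> f x \<in> {1..m - 1}"
      "\<And>x. x \<in> {0..1} \<Longrightarrow> g x \<in> {0..1}" "\<And>x. x \<in> {0..1} \<Longrightarrow> clog_map m (f x) (g x) = x"
    using clog_map_covers[OF assms(1)] by metis
  \<comment> \<open>The functions \<open>f\<close> and \<open>g\<close> choose a digit and a
    remainder. Iterating \<open>g\<close> gives the remainder \<open>y n\<close> left after
    \<open>n\<close> digits, and the next digit is \<open>f (y n)\<close>.\<close>
  define y where "y n = (g ^^ n) x" for n
  have y: "y n \<in> {0..1}" for n
    by (induction n) (use fg(2) assms(2) in \<open>auto simp: y_def\<close>)
  have comp: "clog_comp m (\<lambda>n. f (y n)) n (y n) = x" for n
  proof (induction n)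
    case (Suc n)
    then show ?case
      using fg(3)[OF y[of n]] by (simp add: y_def)
  qed (simp add: y_def)
  show ?thesis
    using clog_representationI[of m "\<lambda>n. f (y n)" y x, OF assms(1) fg(1)[OF y] y comp] by blast
qed

text \<open>The defining recursion adds maps on the inside; splitting off the first digit requires
  the outermost map instead.\<close>

lemma clog_comp_Suc_shift:
  "clog_comp m d (Suc n) x = clog_map m (d 0) (clog_comp m (\<lambda>k. d (Suc k)) n x)"
  by (induction n arbitrary: x) simp_all

lemma clog_comp_in_unit:
  assumes "m \<ge> 3" "\<And>k. d k \<in> {1..m - 1}" "x \<in> {0..1}"
  shows "clog_comp m d n x \<in> {0..1}"
  using assms(3)
proof (induction n arbitrary: x)
  case (Suc n)
  have "real (d n) + x \<le> real m" "d n \<ge> 1"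
    using assms(1) assms(2)[of n] Suc.prems by auto
  then have "clog_map m (d n) x \<in> {0..1}"
    using Suc.prems assms(1) by (simp add: clog_map_def)
  then show ?case
    using Suc.IH by simp
qed simp

text \<open>The outermost map has a continuous inverse, and applying it to the convergent
  compositions shows that the compositions of the shifted sequence converge as well.\<close>

lemma clog_representation_tail:
  assumes "m \<ge> 3" "clog_representation m d x"
  obtains y where "y \<in> {0..1}" "clog_representation m (\<lambda>k. d (Suc k)) y" "clog_map m (d 0) y = x"
proof -
  define s where "s = (\<lambda>n. clog_comp m (\<lambda>k. d (Suc k)) n 0)"
  \<comment> \<open>This is the inverse of \<open>clog_map m (d 0)\<close> applied to
    \<open>x\<close>.\<close>
  define y where "y = real m powr x - real (d 0)"
  have d: "d k \<in> {1..m - 1}" for k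
    using assms(2) by (simp add: clog_representation_def)
  have s: "s n \<in> {0..1}" for n
    unfolding s_def using d assms(1) by (intro clog_comp_in_unit) auto
  have "(\<lambda>n. clog_comp m d (Suc n) 0) \<longlonglongrightarrow> x"
    using assms(2) unfolding clog_representation_def by (intro LIMSEQ_Suc) blast
  then have "(\<lambda>n. clog_map m (d 0) (s n)) \<longlonglongrightarrow> x"
    by (simp only: clog_comp_Suc_shift s_def)
  then have "(\<lambda>n. real m powr clog_map m (d 0) (s n) - real (d 0)) \<longlonglongrightarrow> y"
    unfolding y_def using assms(1) by (intro tendsto_intros) auto
  moreover have "real m powr clog_map m (d 0) (s n) - real (d 0) = s n" for n
    using s[of n] d[of 0] assms(1) by (simp add: clog_map_def)
  ultimately have lim: "s \<longlonglongrightarrow> y"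
    by simp
  have "y \<in> {0..1}"
    using s lim closed_sequentially[OF closed_atLeastAtMost] by blast
  moreover have "clog_representation m (\<lambda>k. d (Suc k)) y"
    using lim d by (simp add: clog_representation_def s_def)
  moreover have "clog_map m (d 0) y = x"
    using assms(1) by (simp add: clog_map_def y_def)
  ultimately show thesis
    using that by blast
qed

lemma clog_map_eqD:
  assumes "m \<ge> 3" "d \<ge> 1" "e \<ge> 1" "y \<ge> 0" "z \<ge> 0" "clog_map m d y = clog_map m e z"
  shows "real d + y = real e + z"
proof -
  have "real m powr clog_map m d y = real m powr clog_map m e z"
    using assms(6) by simp
  then show ?thesis
    using assms(1-5) by (simp add: clog_map_def)
qed

text \<open>From \<open>d + y = e + z\<close> with \<open>y \<le> 1\<close> and
  \<open>d + 1 \<le> e\<close> it follows that \<open>e + z \<le> e\<close>. The images of two maps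
  thus meet at most in the left endpoint of the one with the larger digit.\<close>

lemma clog_map_overlap:
  assumes "m \<ge> 3" "d \<ge> 1" "d < e" "y \<in> {0..1}" "z \<in> {0..1}" "clog_map m d y = clog_map m e z"
  shows "z = 0"
proof -
  have "real d + y = real e + z"
    using assms by (intro clog_map_eqD) auto
  moreover have "real d + 1 \<le> real e"
    using assms(3) by linarith
  ultimately show ?thesis
    using assms(4,5) by auto
qed

text \<open>Induction on the first index of disagreement, with the sequences and \<open>x\<close>
  generalized so that the hypothesis applies to tails.\<close>

lemma clog_representations_differ:
  assumes "m \<ge> 3" "clog_representation m d x" "clog_representation m e x"
    and "\<And>k. k < n \<Longrightarrow> d k = e k" "d n \<noteq> e n"
  shows "x \<in> range (\<lambda>ds. foldr (clog_map m) ds 0)"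
  using assms(2-)
proof (induction n arbitrary: d e x)
  case 0
  obtain y where y: "y \<in> {0..1}" "clog_map m (d 0) y = x"
    using clog_representation_tail[OF assms(1) 0(1)] by blast
  obtain z where z: "z \<in> {0..1}" "clog_map m (e 0) z = x"
    using clog_representation_tail[OF assms(1) 0(2)] by blast
  have "d 0 \<ge> 1" "e 0 \<ge> 1"
    using 0(1,2) by (auto simp: clog_representation_def)
  \<comment> \<open>Whichever sequence has the larger first digit has remainder 0.\<close>
  then have "x = foldr (clog_map m) [e 0] 0 \<or> x = foldr (clog_map m) [d 0] 0"
    using clog_map_overlap[OF assms(1), of "d 0" "e 0" y z]
      clog_map_overlap[OF assms(1), of "e 0" "d 0" z y] y z 0(4)
    by (cases "d 0" "e 0" rule: linorder_cases) auto
  then show ?case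
    by blast
next
  case (Suc n)
  obtain y where y: "y \<in> {0..1}" "clog_representation m (\<lambda>k. d (Suc k)) y" "clog_map m (d 0) y = x"
    using clog_representation_tail[OF assms(1) Suc.prems(1)] by blast
  obtain z where z: "z \<in> {0..1}" "clog_representation m (\<lambda>k. e (Suc k)) z" "clog_map m (e 0) z = x"
    using clog_representation_tail[OF assms(1) Suc.prems(2)] by blast
  have "d 0 = e 0"
    using Suc.prems(3) by simp
  moreover have "d 0 \<ge> 1"
    using Suc.prems(1) by (simp add: clog_representation_def)
  \<comment> \<open>The common first map is injective, so both tails represent the same
    number.\<close>
  ultimately have "z = y"
    using clog_map_eqD[OF assms(1), of "d 0" "e 0" y z] y z by auto
  then have "y \<in> range (\<lambda>ds. foldr (clog_map m) ds 0)"
    using Suc.IH[OF y(2)] z(2) Suc.prems(3,4) by simp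
  then obtain ds where "y = foldr (clog_map m) ds 0"
    by blast
  then have "x = foldr (clog_map m) (d 0 # ds) 0"
    using y(3) by simp
  then show ?case
    by blast
qed

theorem theorem1p1:
  fixes m :: nat
  assumes "m \<ge> 3"
  shows "(\<forall>x\<in>{0..1::real}. \<exists>d. clog_representation m d x) \<and>
    (\<exists>E\<subseteq>{0..1::real}. countable E \<and> (\<forall>x\<in>{0..1} - E. \<exists>!d. clog_representation m d x))"
proof (intro conjI ballI)
  show "\<exists>d. clog_representation m d x" if "x \<in> {0..1}" for x
    using clog_representation_exists[OF assms that] .
  \<comment> \<open>Finite lists of naturals are countable, hence so is \<open>R\<close>. The lists
    are not restricted to admissible digits, so \<open>R\<close> can leave the unit interval and is
    intersected with it below.\<close>
  define R where "R = range (\<lambda>ds. foldr (clog_map m) ds (0 :: real))"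
  show "\<exists>E\<subseteq>{0..1::real}. countable E \<and> (\<forall>x\<in>{0..1} - E. \<exists>!d. clog_representation m d x)"
  proof (intro exI[of _ "{0..1} \<inter> R"] conjI ballI)
    show "countable ({0..1} \<inter> R)"
      unfolding R_def by (intro countable_Int2 countable_image) simp
    fix x :: real
    assume "x \<in> {0..1} - {0..1} \<inter> R"
    then have x: "x \<in> {0..1}" "x \<notin> R"
      by blast+
    obtain d where d: "clog_representation m d x"
      using clog_representation_exists[OF assms x(1)] by blast
    show "\<exists>!d. clog_representation m d x"
    proof (rule ex1I, rule d, rule ccontr)
      fix e
      assume e: "clog_representation m e x" and "e \<noteq> d"
      then have "\<exists>n. e n \<noteq> d n"
        by blast
      then obtain n where n: "e n \<noteq> d n" "\<And>k. k < n \<Longrightarrow> e k = d k"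
        unfolding exists_least_iff[of "\<lambda>n. e n \<noteq> d n"] by blast
      have "x \<in> R"
        unfolding R_def by (rule clog_representations_differ[OF assms e d n(2,1)])
      with x(2) show False
        by contradiction
    qed
  qed simp
qed

end
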